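(* Let $k\geq 1$ be an integer. For every real $x$ with $-1\leq x<1$, \[(-1)^k\frac{(1-x)^{k-1}}{(k-1)!}\log(1-x) - C_k (1-x)^{k-1} + \sum_{j=1}^{k}C_j\frac{x^{k-j}}{(k-j)!} = \sum_{n=1}^{\infty}\frac{x^{n+k-1}}{n(n+1)\cdots(n+k-1)},\] where the series on the right converges. Moreover, if $k\geq 2$, the series on the right also converges at $x=1$, and its value at $x=1$ equals the limit of the left-hand side as $x\to 1^{-}$.
   Context: $\log$ denotes the natural logarithm. Let $H_0=0$ and $H_\ell=\sum_{i=1}^{\ell}\frac{1}{i}$ for $\ell\ge 1$. For every integer $j\geq 1$, define $C_j=\frac{(-1)^j}{(j-1)!}H_{j-1}$. *)

theory Defs
  imports "HOL-Analysis.Harmonic_Numbers"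
begin

definition C :: "nat \<Rightarrow> real" where
  "C j = (-1) ^ j / fact (j - 1) * harm (j - 1)"

definition closed_form :: "nat \<Rightarrow> real \<Rightarrow> real" where
  "closed_form k x =
     (-1) ^ k * ((1 - x) ^ (k - 1) / fact (k - 1)) * ln (1 - x)
     - C k * (1 - x) ^ (k - 1)
     + (\<Sum>j=1..k. C j * (x ^ (k - j) / fact (k - j)))"

definition series_term :: "nat \<Rightarrow> real \<Rightarrow> nat \<Rightarrow> real" where
  "series_term k x n = x ^ (n + k - 1) / (\<Prod>i<k. real (n + i))"

end

theory Submission
  imports Defs "HOL-Real_Asymp.Real_Asymp"
begin

text \<open>
  Both sides satisfy the recurrence \<open>k F\<^sub>k\<^sub>+\<^sub>1(x) = (x - 1) F\<^sub>k(x) + x\<^sup>k / k!\<close>.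
  For the series this is the partial fraction identity
  \<open>k / (n \<cdots> (n+k)) = 1 / (n \<cdots> (n+k-1)) - 1 / ((n+1) \<cdots> (n+k))\<close>; for the closed form it is the
  recurrence \<open>k C\<^sub>k\<^sub>+\<^sub>1 = - C\<^sub>k - (-1)\<^sup>k / k!\<close> together with the binomial expansion of \<open>(x - 1)\<^sup>k\<close>.
  Induction on \<open>k\<close> from the logarithm series then gives the identity, the endpoint \<open>x = -1\<close> included.
  At \<open>x = 1\<close> the series with index \<open>k + 1\<close> telescopes to \<open>1 / (k k!)\<close>, which is also the limit read off
  the recurrence of the closed form because \<open>(1 - x) ln (1 - x) \<rightarrow> 0\<close>.
\<close>

text \<open>Over the common denominator \<open>n \<cdots> (n + k)\<close>, the first product lacks
  the last factor \<open>n + k\<close> and the second lacks the first factor \<open>n\<close>, so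
  the numerators differ by \<open>k\<close>.\<close>

lemma shifted_prod_reciprocal_diff:
  fixes n :: nat
  assumes "n > 0"
  shows "1 / (\<Prod>i<k. real (n + i)) - 1 / (\<Prod>i<k. real (Suc n + i))
         = real k / (\<Prod>i<Suc k. real (n + i))"
proof -
  let ?P = "\<Prod>i<k. real (n + i)" and ?Q = "\<Prod>i<k. real (Suc n + i)"
  have right: "(\<Prod>i<Suc k. real (n + i)) = ?P * real (n + k)"
    by simp
  have left: "(\<Prod>i<Suc k. real (n + i)) = real n * ?Q"
    by (subst prod.lessThan_Suc_shift) simp
  have "1 / ?P = real (n + k) / (\<Prod>i<Suc k. real (n + i))"
    unfolding right using assms by simp
  moreover have "1 / ?Q = real n / (\<Prod>i<Suc k. real (n + i))"
    unfolding left using assms by simp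
  ultimately show ?thesis
    by (simp only: diff_divide_distrib[symmetric]) simp
qed

lemma prod_real_Suc_eq_fact: "(\<Prod>i<k. real (Suc i)) = fact k"
  by (induction k) (simp_all add: mult.commute)

lemma series_term_recurrence:
  assumes "k > 0" and "n > 0"
  shows "real k * series_term (Suc k) x n = x * series_term k x n - series_term k x (Suc n)"
proof -
  have "real k * series_term (Suc k) x n = x ^ (n + k) * (real k / (\<Prod>i<Suc k. real (n + i)))"
    by (simp add: series_term_def)
  also have "\<dots> = x ^ (n + k) / (\<Prod>i<k. real (n + i)) - x ^ (n + k) / (\<Prod>i<k. real (Suc n + i))"
    by (simp only: shifted_prod_reciprocal_diff[OF assms(2), symmetric]) (simp add: right_diff_distrib)
  \<comment> \<open>The exponent in \<open>series_term\<close> is a truncated difference; positivity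
    makes it a true predecessor. The shifted term already carries
    \<open>x ^ (n + k)\<close>.\<close>
  also have "x ^ (n + k) = x * x ^ (n + k - 1)"
    using assms by (cases k) auto
  finally show ?thesis
    using assms by (simp add: series_term_def power_Suc[symmetric] del: power_Suc)
qed

lemma series_term_one: "series_term k x (Suc 0) = x ^ k / fact k"
  by (simp add: series_term_def prod_real_Suc_eq_fact[symmetric])

text \<open>Sum the termwise recurrence: the shifted series is the old one without its first term
  \<open>x ^ k / fact k\<close>.\<close>

lemma series_sums_recurrence:
  assumes "k > 0" and "(\<lambda>n. series_term k x (Suc n)) sums S"
  shows "(\<lambda>n. series_term (Suc k) x (Suc n)) sums (((x - 1) * S + x ^ k / fact k) / real k)"
proof -
  have "(\<lambda>n. series_term k x (Suc (Suc n))) sums (S - x ^ k / fact k)"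
    using assms(2) by (subst sums_Suc_iff) (simp add: series_term_one)
  from sums_diff[OF sums_mult[OF assms(2), of x] this]
  have "(\<lambda>n. real k * series_term (Suc k) x (Suc n)) sums (x * S - (S - x ^ k / fact k))"
    using assms(1) by (simp add: series_term_recurrence)
  from sums_divide[OF this, of "real k"] show ?thesis
    using assms(1) by (simp add: algebra_simps)
qed

text \<open>Induction on sums cannot start at \<open>x = 1\<close>, where index 1 gives the
  divergent harmonic series. Telescoping only requires the terms of index \<open>k\<close> to vanish
  in the limit.\<close>

lemma series_at_one_sums:
  assumes "k > 0"
  shows "(\<lambda>n. series_term (Suc k) 1 (Suc n)) sums (1 / (real k * fact k))"
proof -
  have lim: "(\<lambda>n. series_term k 1 (Suc n)) \<longlonglongrightarrow> 0"
  proof (rule tendsto_sandwich)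
    show "eventually (\<lambda>n. 0 \<le> series_term k 1 (Suc n)) sequentially"
      by (auto simp: series_term_def intro!: always_eventually divide_nonneg_nonneg prod_nonneg)
    have "series_term k 1 (Suc n) \<le> 1 / real (Suc n)" for n
    proof -
      \<comment> \<open>Only the factor at \<open>i = 0\<close> is kept; every other factor is at
        least 1.\<close>
      have "real (Suc n) * 1 \<le> real (Suc n) * (\<Prod>i\<in>{..<k} - {0}. real (Suc n + i))"
        by (intro mult_left_mono prod_ge_1) auto
      also have "\<dots> = (\<Prod>i<k. real (Suc n + i))"
        using assms by (subst prod.remove[of _ 0]) auto
      finally show ?thesis
        by (auto simp: series_term_def intro!: divide_left_mono mult_pos_pos prod_pos)
    qed
    then show "eventually (\<lambda>n. series_term k 1 (Suc n) \<le> 1 / real (Suc n)) sequentially"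
      by (intro always_eventually allI)
    show "(\<lambda>n. 1 / real (Suc n)) \<longlonglongrightarrow> 0"
      using LIMSEQ_inverse_real_of_nat by (simp add: inverse_eq_divide)
  qed simp
  from telescope_sums'[OF lim]
  have "(\<lambda>n. real k * series_term (Suc k) 1 (Suc n)) sums (1 / fact k)"
    using assms by (simp add: series_term_recurrence series_term_one)
  from sums_divide[OF this, of "real k"] show ?thesis
    using assms by (simp add: mult.commute)
qed

text \<open>Splitting \<open>harm i\<close> as \<open>harm (i - 1) + 1 / i\<close> yields the two
  terms on the right.\<close>

lemma C_recurrence:
  assumes "i > 0"
  shows "real i * C (Suc i) = - C i - (-1) ^ i / fact i"
proof -
  obtain m where "i = Suc m"
    using assms by (cases i) auto
  then show ?thesis
    by (simp add: C_def harm_Suc field_simps del: of_nat_Suc)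
qed

lemma sum_C_recurrence:
  fixes x :: real
  shows "real k * (\<Sum>j=1..Suc k. C j * (x ^ (Suc k - j) / fact (Suc k - j)))
         = (x - 1) * (\<Sum>j=1..k. C j * (x ^ (k - j) / fact (k - j)))
           + x ^ k / fact k - (x - 1) ^ k / fact k"
proof -
  define t where "t m = x ^ m / fact m" for m
  define p where "p = (\<Sum>j=1..k. C j * t (k - j))"
  have t_Suc: "real (Suc m) * t (Suc m) = x * t m" for m
    by (simp add: t_def field_simps del: of_nat_Suc)
  have binom: "(\<Sum>i\<le>k. (-1) ^ i / fact i * t (k - i)) = (x - 1) ^ k / fact k"
  proof -
    have "(x - 1) ^ k = (-1 + x) ^ k"
      by simp
    also have "\<dots> = (\<Sum>i\<le>k. real (k choose i) * (-1) ^ i * x ^ (k - i))"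
      by (rule binomial_ring)
    finally have "(x - 1) ^ k / fact k = (\<Sum>i\<le>k. real (k choose i) * (-1) ^ i * x ^ (k - i) / fact k)"
      by (simp add: sum_divide_distrib)
    also have "\<dots> = (\<Sum>i\<le>k. (-1) ^ i / fact i * t (k - i))"
      by (intro sum.cong) (auto simp: t_def binomial_fact)
    finally show ?thesis ..
  qed
  have split: "(\<Sum>i\<le>k. f i) = f 0 + (\<Sum>i=1..k. f i)" for f :: "nat \<Rightarrow> real"
    by (simp add: atMost_atLeast0 sum.atLeast_Suc_atMost)
  \<comment> \<open>The weight is split as \<open>k = (Suc k - j) + (j - 1)\<close>: the first part
    lowers the power of \<open>x\<close> through \<open>t_Suc\<close>, the second feeds
    \<open>C_recurrence\<close>.\<close>
  have "real k * (\<Sum>j=1..Suc k. C j * t (Suc k - j))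
        = (\<Sum>j=1..Suc k. real (Suc k - j) * C j * t (Suc k - j))
          + (\<Sum>j=1..Suc k. real (j - 1) * C j * t (Suc k - j))"
    unfolding sum_distrib_left sum.distrib[symmetric]
    by (intro sum.cong) (auto simp: of_nat_diff algebra_simps)
  also have "(\<Sum>j=1..Suc k. real (Suc k - j) * C j * t (Suc k - j))
             = (\<Sum>j=1..k. real (Suc k - j) * C j * t (Suc k - j))"
    by simp
  also have "\<dots> = (\<Sum>j=1..k. x * (C j * t (k - j)))"
  proof (intro sum.cong refl)
    fix j assume "j \<in> {1..k}"
    then have "real (Suc k - j) * t (Suc k - j) = x * t (k - j)"
      using t_Suc[of "k - j"] by (simp add: Suc_diff_le)
    then show "real (Suc k - j) * C j * t (Suc k - j) = x * (C j * t (k - j))"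
      by (simp add: mult.left_commute mult.assoc)
  qed
  also have "\<dots> = x * p"
    by (simp add: p_def sum_distrib_left)
  also have "(\<Sum>j=1..Suc k. real (j - 1) * C j * t (Suc k - j))
             = (\<Sum>i\<le>k. real i * C (Suc i) * t (k - i))"
    by (simp add: atMost_atLeast0 sum.shift_bounds_cl_Suc_ivl del: sum.cl_ivl_Suc)
  \<comment> \<open>The weight \<open>i\<close> removes the term at 0, so
    \<open>C_recurrence\<close> applies to all that remain. In the binomial sum the term at 0 is
    \<open>t k\<close>, which is subtracted next.\<close>
  also have "\<dots> = (\<Sum>i=1..k. - (C i * t (k - i)) - (-1) ^ i / fact i * t (k - i))"
    unfolding split by (auto simp: C_recurrence algebra_simps intro!: sum.cong)
  also have "\<dots> = - p - ((x - 1) ^ k / fact k - t k)"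
    unfolding binom[symmetric] split by (simp add: sum_subtractf sum_negf p_def)
  finally show ?thesis
    by (simp add: t_def p_def algebra_simps)
qed

text \<open>The logarithmic part scales exactly by \<open>x - 1\<close>. The remainder
  \<open>(x - 1) ^ k / fact k\<close> of the polynomial sum cancels the one that
  \<open>C_recurrence\<close> leaves in the \<open>C k\<close> term.\<close>

lemma closed_form_recurrence:
  assumes "k > 0"
  shows "real k * closed_form (Suc k) x = (x - 1) * closed_form k x + x ^ k / fact k"
proof -
  obtain m where m: "k = Suc m"
    using assms by (cases k) auto
  define L y where "L = ln (1 - x)" and "y = 1 - x"
  define p q where "p = (\<Sum>j=1..k. C j * (x ^ (k - j) / fact (k - j)))"
    and "q = (\<Sum>j=1..Suc k. C j * (x ^ (Suc k - j) / fact (Suc k - j)))"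
  have "(x - 1) ^ k = (-1) ^ k * y ^ k"
    by (simp add: y_def flip: power_mult_distrib)
  then have sums: "real k * q = - y * p + x ^ k / fact k - (-1) ^ k * y ^ k / fact k"
    using sum_C_recurrence[of k x] by (simp add: p_def q_def y_def)
  have log: "real k * ((-1) ^ Suc k * (y ^ k / fact k) * L) = - y * ((-1) ^ k * (y ^ m / fact m) * L)"
    by (simp add: m field_simps del: of_nat_Suc)
  have const: "real k * C (Suc k) * y ^ k = - y * C k * y ^ m - (-1) ^ k * y ^ k / fact k"
    by (simp only: C_recurrence[OF assms]) (simp add: m algebra_simps)
  have "real k * closed_form (Suc k) x
        = real k * ((-1) ^ Suc k * (y ^ k / fact k) * L) - real k * C (Suc k) * y ^ k + real k * q"
    by (simp add: closed_form_def L_def y_def q_def algebra_simps)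
  also have "\<dots> = - y * ((-1) ^ k * (y ^ m / fact m) * L - C k * y ^ m + p) + x ^ k / fact k"
    unfolding log const sums by (simp add: algebra_simps)
  also have "\<dots> = (x - 1) * closed_form k x + x ^ k / fact k"
    by (simp add: closed_form_def L_def y_def p_def m)
  finally show ?thesis .
qed

lemma ln_series_sums:
  fixes x :: real
  assumes "-1 \<le> x" and "x < 1"
  shows "(\<lambda>n. x ^ Suc n / real (Suc n)) sums (- ln (1 - x))"
proof (cases "x = -1")
  case True
  have "(\<lambda>n. - ((-1) ^ n / real (Suc n))) sums (- ln 2)"
    using sums_minus[OF alternating_harmonic_series_sums] by simp
  then show ?thesis
    using True by simp
next
  case False
  then have "\<bar>- x\<bar> < 1"
    using assms by simp
  from sums_minus[OF ln_series'[OF this]]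
  have "(\<lambda>n. x ^ n / real n) sums (- ln (1 - x))"
    by (simp add: power_minus[of x] flip: power_mult_distrib)
  then show ?thesis
    by (subst sums_Suc_iff) simp
qed

lemma series_sums_closed_form:
  assumes "-1 \<le> x" and "x < 1"
  shows "(\<lambda>n. series_term (Suc m) x (Suc n)) sums closed_form (Suc m) x"
proof (induction m)
  case 0
  \<comment> \<open>Here \<open>C 1 = 0\<close>, so the closed form is just
    \<open>- ln (1 - x)\<close>.\<close>
  show ?case
    using ln_series_sums[OF assms] by (simp add: series_term_def closed_form_def C_def harm_def)
next
  case (Suc m)
  have "closed_form (Suc (Suc m)) x
        = ((x - 1) * closed_form (Suc m) x + x ^ Suc m / fact (Suc m)) / real (Suc m)"
    by (simp only: closed_form_recurrence[OF zero_less_Suc, symmetric]) simp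
  then show ?case
    using series_sums_recurrence[OF zero_less_Suc Suc] by simp
qed

lemma closed_form_tendsto_at_left_one:
  assumes "k > 0"
  shows "(closed_form (Suc k) \<longlongrightarrow> 1 / (real k * fact k)) (at_left 1)"
proof -
  have log: "((\<lambda>x::real. (1 - x) * ln (1 - x)) \<longlongrightarrow> 0) (at_left 1)"
    by real_asymp
  \<comment> \<open>The extra factor \<open>1 - x\<close> is attached to the logarithm and to the
    polynomial part, so the product vanishes even for \<open>k = 1\<close>, where
    \<open>closed_form k\<close> itself is unbounded.\<close>
  have "((\<lambda>x. (-1) ^ k * ((1 - x) ^ (k - 1) / fact (k - 1)) * ((1 - x) * ln (1 - x))
           + (1 - x) * ((\<Sum>j=1..k. C j * (x ^ (k - j) / fact (k - j))) - C k * (1 - x) ^ (k - 1)))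
         \<longlongrightarrow> (-1) ^ k * ((1 - 1) ^ (k - 1) / fact (k - 1)) * 0
           + (1 - 1) * ((\<Sum>j=1..k. C j * (1 ^ (k - j) / fact (k - j))) - C k * (1 - 1) ^ (k - 1)))
         (at_left 1)"
    by (intro tendsto_intros log) auto
  then have "((\<lambda>x. (1 - x) * closed_form k x) \<longlongrightarrow> 0) (at_left 1)"
    by (simp add: closed_form_def algebra_simps)
  then have "((\<lambda>x. (x ^ k / fact k - (1 - x) * closed_form k x) / real k)
               \<longlongrightarrow> (1 ^ k / fact k - 0) / real k) (at_left 1)"
    using assms by (intro tendsto_intros) auto
  moreover have "closed_form (Suc k) = (\<lambda>x. (x ^ k / fact k - (1 - x) * closed_form k x) / real k)"
    using closed_form_recurrence[OF assms] assms by (simp add: fun_eq_iff field_simps)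
  ultimately show ?thesis
    by (simp add: mult.commute)
qed

theorem theorem2p7:
  fixes k :: nat
  assumes "k \<ge> 1"
  shows "(\<forall>x::real. -1 \<le> x \<and> x < 1 \<longrightarrow>
            summable (\<lambda>n. series_term k x (Suc n)) \<and>
            closed_form k x = (\<Sum>n. series_term k x (Suc n))) \<and>
         (k \<ge> 2 \<longrightarrow>
            summable (\<lambda>n. series_term k 1 (Suc n)) \<and>
            (closed_form k \<longlongrightarrow> (\<Sum>n. series_term k 1 (Suc n))) (at_left 1))"
proof -
  obtain m where m: "k = Suc m"
    using assms by (cases k) auto
  show ?thesis
  proof (intro conjI allI impI; (elim conjE)?)
    fix x :: real
    assume "-1 \<le> x" "x < 1"
    then have "(\<lambda>n. series_term k x (Suc n)) sums closed_form k x"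
      unfolding m by (rule series_sums_closed_form)
    then show "summable (\<lambda>n. series_term k x (Suc n))"
      and "closed_form k x = (\<Sum>n. series_term k x (Suc n))"
      by (auto simp: sums_iff)
  next
    assume "k \<ge> 2"
    then have "m > 0"
      by (simp add: m)
    then show "summable (\<lambda>n. series_term k 1 (Suc n))"
      and "(closed_form k \<longlongrightarrow> (\<Sum>n. series_term k 1 (Suc n))) (at_left 1)"
      using series_at_one_sums[of m] closed_form_tendsto_at_left_one[of m]
      by (auto simp: m sums_iff)
  qed
qed

end
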